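(* For every $k\in\{1,2,3\}$, the sequence $(d_k(p))_p$, indexed by the primes $p$ in increasing order, is unimodular. For every integer $k$ with $4\le k\le 20$, the sequence $(d_k(p))_p$ is not unimodular.
   Context: For an integer $k\ge 1$ and a prime $p$, $d_k(p)$ denotes the natural density of the set of positive integers whose $k$-th prime is $p$, i.e. the integers $x$ such that $p$ is the $k$-th smallest among the distinct prime divisors of $x$ (equivalently, $p\mid x$ and exactly $k-1$ distinct primes smaller than $p$ divide $x$). A real sequence is called unimodular (i.e. unimodal) if it has at most one local maximum. A local maximum is a maximal block of consecutive indices on which the sequence is constant, such that every term adjacent to the block (the term just before it, if any, and the term just after it, if any) is strictly smaller than the common value on the block. *)

theory Defs
  imports Complex_Main "HOL-Library.Infinite_Set" "HOL-Computational_Algebra.Primes"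
begin

definition natural_density :: "nat set \<Rightarrow> real" where
  "natural_density A = lim (\<lambda>N. real (card (A \<inter> {1..N})) / real N)"

definition kth_prime_is :: "nat \<Rightarrow> nat \<Rightarrow> nat set" where
  "kth_prime_is k p = {x. x > 0 \<and> p dvd x \<and> Suc (card {q. prime q \<and> q < p \<and> q dvd x}) = k}"

(* For prime p the set below is periodic (with period the product of the primes up to p),
   so its density exists and lim is not a junk value. *)
definition d :: "nat \<Rightarrow> nat \<Rightarrow> real" where
  "d k p = natural_density (kth_prime_is k p)"

(* Indexing starts at 0: nth_prime 0 = 2. *)
definition nth_prime :: "nat \<Rightarrow> nat" where
  "nth_prime = enumerate {p. prime p}"

(* Blocks may be infinite, so that an eventually constant tail is covered. *)
definition constant_block :: "(nat \<Rightarrow> real) \<Rightarrow> nat set \<Rightarrow> bool" where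
  "constant_block s B \<longleftrightarrow>
     B \<noteq> {} \<and> (\<forall>i\<in>B. \<forall>j\<in>B. {i..j} \<subseteq> B) \<and> (\<forall>i\<in>B. \<forall>j\<in>B. s i = s j)"

definition local_maximum :: "(nat \<Rightarrow> real) \<Rightarrow> nat set \<Rightarrow> bool" where
  "local_maximum s B \<longleftrightarrow>
     constant_block s B \<and>
     (\<forall>C. constant_block s C \<and> B \<subseteq> C \<longrightarrow> C = B) \<and>
     (\<forall>i\<in>B. \<forall>j. j \<notin> B \<and> (j = Suc i \<or> i = Suc j) \<longrightarrow> s j < s i)"

definition unimodular :: "(nat \<Rightarrow> real) \<Rightarrow> bool" where
  "unimodular s \<longleftrightarrow> (\<exists>\<^sub>\<le>\<^sub>1 B. local_maximum s B)"

end

theory Submission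
  imports Defs
begin

text \<open>
  Let \<open>N n j\<close> be the coefficient of \<open>X^j\<close> in the product of \<open>p - 1 + X\<close> over the first
  \<open>n\<close> primes. With \<open>p < q\<close> the primes number \<open>n\<close> and \<open>n + 1\<close> (counted from \<open>0\<close>), the density
  \<open>d k p\<close> is \<open>N n (k - 1)\<close> divided by the product of the primes up to \<open>p\<close>, and so the sequence
  falls from \<open>p\<close> to \<open>q\<close> iff \<open>N n (k - 2) < (q - p + 1) * N n (k - 1)\<close>. For \<open>k \<le> 3\<close> an
  induction on \<open>n\<close> shows that this (or equality) always holds from some prime on, before which
  the sequence does not fall. For \<open>k \<ge> 4\<close> the sequence starts at \<open>0\<close>, is nonnegative and tends to
  \<open>0\<close>, hence one fall followed by a later rise forces two local maxima. For \<open>4 \<le> k \<le> 20\<close> these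
  are caused by prime gaps up to \<open>1153\<close>: for example \<open>1129, 1151, 1153\<close> for \<open>k = 20\<close>.
\<close>

section \<open>Unimodality\<close>

lemma constant_block_eq: "constant_block s B \<Longrightarrow> i \<in> B \<Longrightarrow> j \<in> B \<Longrightarrow> s i = s j"
  unfolding constant_block_def by blast

lemma constant_block_convex:
  "constant_block s B \<Longrightarrow> i \<in> B \<Longrightarrow> j \<in> B \<Longrightarrow> i \<le> x \<Longrightarrow> x \<le> j \<Longrightarrow> x \<in> B"
  unfolding constant_block_def by (meson atLeastAtMost_iff subsetD)

lemma constant_block_nonempty: "constant_block s B \<Longrightarrow> B \<noteq> {}"
  unfolding constant_block_def by (rule conjunct1)

lemma local_maximum_block: "local_maximum s B \<Longrightarrow> constant_block s B"
  unfolding local_maximum_def by (rule conjunct1)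

lemma local_maximum_maximal:
  "local_maximum s B \<Longrightarrow> constant_block s C \<Longrightarrow> B \<subseteq> C \<Longrightarrow> C = B"
  unfolding local_maximum_def by simp

lemma local_maximum_less:
  assumes "local_maximum s B" "i \<in> B" "j \<notin> B" "j = Suc i \<or> i = Suc j"
  shows "s j < s i"
proof -
  have "\<forall>i\<in>B. \<forall>j. j \<notin> B \<and> (j = Suc i \<or> i = Suc j) \<longrightarrow> s j < s i"
    using assms(1) unfolding local_maximum_def by (elim conjE)
  then show ?thesis using assms(2-) by metis
qed

text \<open>The run of equal values around a point \<open>t\<close> where \<open>s\<close> is
  maximal over \<open>{a..c}\<close> works: both endpoint values lie below \<open>s m\<close>, so
  the run cannot reach the endpoints.\<close>

lemma local_maximum_between:
  assumes "a < m" "m < c" "s a < s m" "s c < s m"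
  shows "\<exists>B. local_maximum s B \<and> B \<subseteq> {a<..<c}"
proof -
  define M where "M = Max (s ` {a..c})"
  have le_M: "s x \<le> M" if "x \<in> {a..c}" for x
    using that by (simp add: M_def)
  have "M \<in> s ` {a..c}"
    unfolding M_def using assms by (intro Max_in) auto
  then obtain t where t: "t \<in> {a..c}" "s t = M" by auto
  have "s m \<le> M" using le_M assms by simp
  then have ac: "s a \<noteq> M" "s c \<noteq> M" using assms by auto
  \<comment> \<open>\<open>min\<close> and \<open>max\<close> treat both sides of \<open>t\<close>
    at once; asking for the value \<open>M\<close> on the whole stretch between \<open>x\<close> and
    \<open>t\<close> makes \<open>B\<close> the maximal run.\<close>
  define B where "B = {x. \<forall>y. min x t \<le> y \<and> y \<le> max x t \<longrightarrow> s y = M}"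
  have tB: "t \<in> B" using t by (auto simp: B_def)
  have sB: "s x = M" if "x \<in> B" for x using that by (auto simp: B_def)
  have sub: "B \<subseteq> {a<..<c}"
  proof
    fix x assume x: "x \<in> B"
    then have "\<not> (min x t \<le> a \<and> a \<le> max x t)" "\<not> (min x t \<le> c \<and> c \<le> max x t)"
      using ac by (auto simp: B_def)
    then show "x \<in> {a<..<c}" using t by auto
  qed
  have block: "constant_block s B"
    unfolding constant_block_def
  proof (intro conjI ballI subsetI)
    show "B \<noteq> {}" using tB by auto
  next
    fix i j x assume *: "i \<in> B" "j \<in> B" "x \<in> {i..j}"
    show "x \<in> B" unfolding B_def
    proof (clarify)
      fix y assume "min x t \<le> y" "y \<le> max x t"
      then have "min i t \<le> y \<and> y \<le> max i t \<or> min j t \<le> y \<and> y \<le> max j t"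
        using * by auto
      then show "s y = M" using *(1,2) by (auto simp: B_def)
    qed
  qed (auto simp: sB)
  have maximal: "C = B" if C: "constant_block s C" "B \<subseteq> C" for C
  proof -
    have "x \<in> B" if x: "x \<in> C" for x unfolding B_def
    proof (clarify)
      fix y assume y: "min x t \<le> y" "y \<le> max x t"
      have tC: "t \<in> C" using C tB by auto
      have "min x t \<in> C" "max x t \<in> C" using x tC by (simp_all add: min_def max_def)
      then have "y \<in> C" using constant_block_convex[OF C(1)] y by blast
      then show "s y = M" using constant_block_eq[OF C(1)] tC t by metis
    qed
    then show ?thesis using C by auto
  qed
  have "s j < s i" if "i \<in> B" "j \<notin> B" "j = Suc i \<or> i = Suc j" for i j
  proof -
    have "j \<in> {a..c}" using that sub by fastforce
    \<comment> \<open>Otherwise the run would extend to \<open>j\<close>.\<close>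
    moreover have "s j \<noteq> M"
    proof
      assume "s j = M"
      moreover have "y = j \<or> (min i t \<le> y \<and> y \<le> max i t)"
        if "min j t \<le> y" "y \<le> max j t" for y
        using that \<open>j = Suc i \<or> i = Suc j\<close> by (auto simp: min_def max_def split: if_splits)
      ultimately have "j \<in> B" using \<open>i \<in> B\<close> by (auto simp: B_def)
      then show False using that by simp
    qed
    ultimately show ?thesis using le_M[of j] sB that by force
  qed
  with block maximal sub show ?thesis unfolding local_maximum_def by blast
qed

text \<open>The starting value 0 lies below the term before the fall, and the tail eventually lies
  below the term after the rise. This gives peaks in the disjoint windows
  \<open>{0<..<Suc i}\<close> and \<open>{l<..<c}\<close>.\<close>

lemma not_unimodularI:
  fixes s :: "nat \<Rightarrow> real"
  assumes nonneg: "\<And>n. 0 \<le> s n" and "s 0 = 0" and lim: "s \<longlonglongrightarrow> 0"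
    and i: "s (Suc i) < s i" and l: "s l < s (Suc l)" and "i < l"
  shows "\<not> unimodular s"
proof -
  have "s 0 < s i" using i nonneg[of "Suc i"] \<open>s 0 = 0\<close> by linarith
  moreover from this have "0 < i" by (metis gr0I less_irrefl)
  ultimately obtain B where B: "local_maximum s B" "B \<subseteq> {0<..<Suc i}"
    using local_maximum_between[of 0 i "Suc i" s] i by blast
  have "0 < s (Suc l)" using l nonneg[of l] by linarith
  then have "eventually (\<lambda>n. s n < s (Suc l)) sequentially"
    using lim by (intro order_tendstoD)
  then have "eventually (\<lambda>n. Suc l < n \<and> s n < s (Suc l)) sequentially"
    using eventually_gt_at_top by eventually_elim auto
  then obtain c where "Suc l < c" "s c < s (Suc l)"
    by (auto simp: eventually_sequentially)
  then obtain C where C: "local_maximum s C" "C \<subseteq> {l<..<c}"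
    using local_maximum_between[of l "Suc l" c s] l by blast
  have "B \<noteq> {}" using B(1) local_maximum_block constant_block_nonempty by metis
  moreover have "B \<inter> C = {}" using B(2) C(2) \<open>i < l\<close> by fastforce
  ultimately have "B \<noteq> C" by auto
  then show ?thesis using B(1) C(1) unfolding unimodular_def Uniq_def by blast
qed

text \<open>Walking from a point of a local maximum towards \<open>m\<close> never leads down, so
  the block cannot end before \<open>m\<close>. Two such blocks share \<open>m\<close>, their union
  is again a constant block, and maximality makes them equal.\<close>

lemma unimodularI:
  fixes s :: "nat \<Rightarrow> real"
  assumes up: "\<And>i. i < m \<Longrightarrow> s i \<le> s (Suc i)" and down: "\<And>i. m \<le> i \<Longrightarrow> s (Suc i) \<le> s i"
  shows "unimodular s"
proof -
  have peak: "m \<in> B" if B: "local_maximum s B" for B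
  proof -
    note less = local_maximum_less[OF B]
    obtain i where "i \<in> B" using constant_block_nonempty[OF local_maximum_block[OF B]] by auto
    show ?thesis
    proof (cases "i \<le> m")
      case True
      then show ?thesis
      proof (induction rule: dec_induct)
        case (step x)
        then show ?case using up[of x] less[of x "Suc x"] by force
      qed fact
    next
      case False
      then have "m \<le> i" by simp
      then show ?thesis
      proof (induction rule: inc_induct)
        case (step x)
        then show ?case using down[of x] less[of "Suc x" x] by force
      qed fact
    qed
  qed
  have "B = C" if B: "local_maximum s B" and C: "local_maximum s C" for B C
  proof -
    have bc: "constant_block s B" "constant_block s C"
      using B C by (simp_all add: local_maximum_block)
    have m: "m \<in> B" "m \<in> C" using B C peak by auto
    have val: "s x = s m" if "x \<in> B \<union> C" for x
      using bc m that constant_block_eq by blast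
    have convex: "x \<in> B \<union> C" if "i \<in> B \<union> C" "j \<in> B \<union> C" "i \<le> x" "x \<le> j" for i j x
    proof (cases "x \<le> m")
      case True
      then show ?thesis using bc m that constant_block_convex by blast
    next
      case False
      then have "m \<le> x" by simp
      then show ?thesis using bc m that constant_block_convex by blast
    qed
    have "constant_block s (B \<union> C)"
      unfolding constant_block_def
    proof (intro conjI ballI subsetI)
      show "B \<union> C \<noteq> {}" using m by blast
      show "x \<in> B \<union> C" if "i \<in> B \<union> C" "j \<in> B \<union> C" "x \<in> {i..j}" for i j x
        using that(3) by (intro convex[OF that(1,2)]) simp_all
      show "s i = s j" if "i \<in> B \<union> C" "j \<in> B \<union> C" for i j
        using val[OF that(1)] val[OF that(2)] by simp
    qed
    then show ?thesis using local_maximum_maximal B C by (metis Un_upper1 Un_upper2)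
  qed
  then show ?thesis unfolding unimodular_def Uniq_def by blast
qed

section \<open>Densities\<close>

text \<open>As \<open>lim\<close> is total, convergence is made part of the relation, so that limits
  can be added and multiplied.\<close>

definition has_density :: "nat set \<Rightarrow> real \<Rightarrow> bool" where
  "has_density A x \<longleftrightarrow> (\<lambda>N. real (card (A \<inter> {1..N})) / real N) \<longlonglongrightarrow> x"

lemma natural_density_eq: "has_density A x \<Longrightarrow> natural_density A = x"
  by (simp add: has_density_def natural_density_def limI)

lemma has_density_empty: "has_density {} 0"
  by (simp add: has_density_def)

lemma has_density_pos: "has_density {x. 0 < x} 1"
proof -
  have "{x. 0 < x} \<inter> {1..N} = {1..N}" for N :: nat by auto
  moreover have "eventually (\<lambda>N. 1 = real N / real N) sequentially"
    using eventually_gt_at_top[of 0] by eventually_elim auto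
  then have "(\<lambda>N. real N / real N) \<longlonglongrightarrow> 1"
    by (rule Lim_transform_eventually[rotated]) simp
  ultimately show ?thesis by (simp add: has_density_def)
qed

lemma has_density_Un:
  assumes "has_density A x" "has_density B y" "A \<inter> B = {}"
  shows "has_density (A \<union> B) (x + y)"
proof -
  have "card ((A \<union> B) \<inter> {1..N}) = card (A \<inter> {1..N}) + card (B \<inter> {1..N})" for N
    using assms(3) by (subst card_Un_disjoint[symmetric]) (auto intro: arg_cong[where f = card])
  then show ?thesis
    using tendsto_add assms(1,2) unfolding has_density_def
    by (fastforce simp: add_divide_distrib)
qed

lemma has_density_Diff:
  assumes "has_density A x" "has_density B y" "B \<subseteq> A"
  shows "has_density (A - B) (x - y)"
proof -
  have "real (card ((A - B) \<inter> {1..N})) = real (card (A \<inter> {1..N})) - real (card (B \<inter> {1..N}))" for N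
  proof -
    have "(A - B) \<inter> {1..N} = A \<inter> {1..N} - B \<inter> {1..N}" by auto
    moreover have "B \<inter> {1..N} \<subseteq> A \<inter> {1..N}" using assms(3) by auto
    ultimately show ?thesis
      by (metis card_Diff_subset card_mono finite_Int finite_atLeastAtMost of_nat_diff)
  qed
  then show ?thesis
    using tendsto_diff assms(1,2) unfolding has_density_def
    by (fastforce simp: diff_divide_distrib)
qed

lemma tendsto_div_over_self:
  assumes "q > 0"
  shows "(\<lambda>N. real (N div q) / real N) \<longlonglongrightarrow> 1 / real q"
proof (rule real_tendsto_sandwich)
  have "1 / real q - 1 / real N \<le> real (N div q) / real N" if "0 < N" for N
  proof -
    have "N < q * (N div q) + q"
      using assms by (metis add.commute add_strict_left_mono mod_less_divisor mult_div_mod_eq)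
    then have "real N \<le> real q * real (N div q) + real q"
      by (metis less_imp_le of_nat_add of_nat_le_iff of_nat_mult)
    then have "real N - real q \<le> real q * real (N div q)" by simp
    then have "(real N - real q) / (real q * real N) \<le> real q * real (N div q) / (real q * real N)"
      by (rule divide_right_mono) simp
    then show ?thesis using assms that by (simp add: diff_divide_distrib)
  qed
  then show "eventually (\<lambda>N. 1 / real q - 1 / real N \<le> real (N div q) / real N) sequentially"
    using eventually_gt_at_top[of 0] by (rule eventually_mono[rotated])
  have "real (N div q) / real N \<le> 1 / real q" for N
  proof -
    have "real q * real (N div q) \<le> real N"
      by (metis of_nat_le_iff of_nat_mult times_div_less_eq_dividend)
    then show ?thesis using assms by (cases "N = 0") (simp_all add: field_simps)
  qed
  then show "eventually (\<lambda>N. real (N div q) / real N \<le> 1 / real q) sequentially" by simp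
  have "(\<lambda>N. 1 / real q - 1 / real N) \<longlonglongrightarrow> 1 / real q - 0"
    by (intro tendsto_intros lim_1_over_n)
  then show "(\<lambda>N. 1 / real q - 1 / real N) \<longlonglongrightarrow> 1 / real q" by simp
qed simp

text \<open>By \<open>inv\<close>, multiplication by \<open>q\<close> maps the positive elements of
  \<open>A\<close> up to \<open>N div q\<close> bijectively onto the positive multiples of
  \<open>q\<close> in \<open>A\<close> up to \<open>N\<close>.\<close>

lemma has_density_multiples:
  assumes A: "has_density A x" and q: "q > 0" and inv: "\<And>y. q * y \<in> A \<longleftrightarrow> y \<in> A"
  shows "has_density {y \<in> A. q dvd y} (x / real q)"
proof -
  have card: "card ({y \<in> A. q dvd y} \<inter> {1..N}) = card (A \<inter> {1..N div q})" for N
  proof -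
    have "{y \<in> A. q dvd y} \<inter> {1..N} = (*) q ` (A \<inter> {1..N div q})"
      using q inv by (auto simp: less_eq_div_iff_mult_less_eq mult.commute elim!: dvdE)
    then show ?thesis using q by (simp add: card_image inj_on_def)
  qed
  have "filterlim (\<lambda>N. N div q) sequentially sequentially"
    unfolding filterlim_at_top
  proof
    fix Z
    show "eventually (\<lambda>N. Z \<le> N div q) sequentially"
      using eventually_ge_at_top[of "Z * q"]
      by eventually_elim (use q in \<open>simp add: less_eq_div_iff_mult_less_eq\<close>)
  qed
  then have "(\<lambda>N. real (card (A \<inter> {1..N div q})) / real (N div q)) \<longlonglongrightarrow> x"
    using A unfolding has_density_def by (rule filterlim_compose[rotated])
  then have "(\<lambda>N. real (card (A \<inter> {1..N div q})) / real (N div q) * (real (N div q) / real N))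
      \<longlonglongrightarrow> x * (1 / real q)"
    by (intro tendsto_mult tendsto_div_over_self q)
  \<comment> \<open>For \<open>M = 0\<close> both sides are 0, since the count is 0.\<close>
  moreover have "real (card (A \<inter> {1..M})) / real M * (real M / real N) = real (card (A \<inter> {1..M})) / real N"
    for M N by (cases "M = 0") auto
  ultimately show ?thesis unfolding has_density_def card by (simp only: mult_1_right times_divide_eq_right)
qed

section \<open>Enumeration of the primes\<close>

lemma prime_nth_prime [simp]: "prime (nth_prime n)"
  using enumerate_in_set[OF primes_infinite] by (simp add: nth_prime_def)

lemma nth_prime_less_iff [simp]: "nth_prime m < nth_prime n \<longleftrightarrow> m < n"
  by (simp add: nth_prime_def primes_infinite)

lemma nth_prime_eq_iff [simp]: "nth_prime m = nth_prime n \<longleftrightarrow> m = n"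
  by (metis nth_prime_less_iff linorder_neq_iff)

lemma nth_prime_exists:
  assumes "prime p"
  obtains n where "p = nth_prime n"
  using enumerate_Ex[of "{p. prime p}" p] assms primes_infinite
  by (auto simp: nth_prime_def)

lemma le_nth_prime: "n \<le> nth_prime n"
  by (simp add: nth_prime_def le_enumerate primes_infinite)

lemma nth_prime_pos [simp]: "0 < nth_prime n"
  by (simp add: prime_gt_0_nat)

lemma nth_prime_nonzero [simp]: "nth_prime n \<noteq> 0"
  using nth_prime_pos[of n] by simp

lemma nth_prime_dvd_iff [simp]: "nth_prime i dvd nth_prime n \<longleftrightarrow> i = n"
  by (metis dvd_refl nth_prime_eq_iff prime_nth_prime primes_dvd_imp_eq)

section \<open>Densities as coefficients of a product\<close>

definition exact_divisors :: "nat \<Rightarrow> nat \<Rightarrow> nat set" where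
  "exact_divisors n j = {x. 0 < x \<and> card {i. i < n \<and> nth_prime i dvd x} = j}"

text \<open>The coefficient of \<open>X^j\<close> in the product of \<open>p - 1 + X\<close> over the first \<open>n\<close> primes \<open>p\<close>.\<close>

fun numerator :: "nat \<Rightarrow> nat \<Rightarrow> int" where
  "numerator 0 j = (if j = 0 then 1 else 0)"
| "numerator (Suc n) j = (int (nth_prime n) - 1) * numerator n j +
     (case j of 0 \<Rightarrow> 0 | Suc i \<Rightarrow> numerator n i)"

abbreviation lower_numerator :: "nat \<Rightarrow> nat \<Rightarrow> int" where
  "lower_numerator n j \<equiv> (case j of 0 \<Rightarrow> 0 | Suc i \<Rightarrow> numerator n i)"

abbreviation primorial :: "nat \<Rightarrow> real" where
  "primorial n \<equiv> (\<Prod>i<n. real (nth_prime i))"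

lemma primorial_pos [simp]: "0 < primorial n"
  by (intro prod_pos) simp

text \<open>A prime factor creates no divisibility by smaller primes; this is the invariance that
  \<open>has_density_multiples\<close> asks for.\<close>

lemma exact_divisors_multiple:
  "nth_prime n * y \<in> exact_divisors n j \<longleftrightarrow> y \<in> exact_divisors n j"
proof -
  have "nth_prime i dvd nth_prime n * y \<longleftrightarrow> nth_prime i dvd y" if "i < n" for i
    using that by (simp add: prime_dvd_mult_iff)
  then have "{i. i < n \<and> nth_prime i dvd nth_prime n * y} = {i. i < n \<and> nth_prime i dvd y}"
    by auto
  then show ?thesis by (simp add: exact_divisors_def)
qed

lemma card_prime_divisors_Suc:
  "card {i. i < Suc n \<and> nth_prime i dvd x} =
     card {i. i < n \<and> nth_prime i dvd x} + (if nth_prime n dvd x then 1 else 0)"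
proof -
  have "{i. i < Suc n \<and> nth_prime i dvd x} =
      (if nth_prime n dvd x then insert n else id) {i. i < n \<and> nth_prime i dvd x}"
    by (auto simp: less_Suc_eq)
  then show ?thesis by simp
qed

lemma exact_divisors_Suc_0:
  "exact_divisors (Suc n) 0 = exact_divisors n 0 - {x \<in> exact_divisors n 0. nth_prime n dvd x}"
  unfolding exact_divisors_def card_prime_divisors_Suc by auto

lemma exact_divisors_Suc_Suc:
  "exact_divisors (Suc n) (Suc j) =
     (exact_divisors n (Suc j) - {x \<in> exact_divisors n (Suc j). nth_prime n dvd x}) \<union>
     {x \<in> exact_divisors n j. nth_prime n dvd x}"
  unfolding exact_divisors_def card_prime_divisors_Suc by (auto split: if_splits)

text \<open>With \<open>p = nth_prime n\<close>, the multiples of \<open>p\<close> make up a share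
  \<open>1/p\<close> of each set. Passing to \<open>Suc n\<close> thus keeps the share
  \<open>1 - 1/p\<close> at \<open>j\<close> and gains the share \<open>1/p\<close> from
  \<open>j - 1\<close>, which is the recursion of \<open>numerator\<close>.\<close>

lemma has_density_exact_divisors:
  "has_density (exact_divisors n j) (numerator n j / primorial n)"
proof (induction n arbitrary: j)
  case 0
  have "exact_divisors 0 j = (if j = 0 then {x. 0 < x} else {})"
    by (auto simp: exact_divisors_def)
  then show ?case by (simp add: has_density_empty has_density_pos)
next
  case (Suc n)
  note mult = has_density_multiples[OF Suc nth_prime_pos exact_divisors_multiple]
  note diff = has_density_Diff[OF Suc mult]
  show ?case
  proof (cases j)
    case 0
    then show ?thesis
      using diff[of 0] by (simp add: exact_divisors_Suc_0 field_simps)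
  next
    case (Suc i)
    have "(exact_divisors n (Suc i) - {x \<in> exact_divisors n (Suc i). nth_prime n dvd x}) \<inter>
        {x \<in> exact_divisors n i. nth_prime n dvd x} = {}" by auto
    from has_density_Un[OF diff mult this] show ?thesis
      using Suc by (simp add: exact_divisors_Suc_Suc field_simps)
  qed
qed

lemma kth_prime_is_nth_prime:
  "kth_prime_is (Suc j) (nth_prime n) = {x \<in> exact_divisors n j. nth_prime n dvd x}"
proof -
  have "{q. prime q \<and> q < nth_prime n \<and> q dvd x} = nth_prime ` {i. i < n \<and> nth_prime i dvd x}" for x
    by (auto elim!: nth_prime_exists)
  then have "card {q. prime q \<and> q < nth_prime n \<and> q dvd x} = card {i. i < n \<and> nth_prime i dvd x}" for x
    by (simp add: card_image inj_on_def)
  then show ?thesis by (auto simp: kth_prime_is_def exact_divisors_def)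
qed

lemma d_nth_prime: "d (Suc j) (nth_prime n) = numerator n j / primorial (Suc n)"
  unfolding d_def kth_prime_is_nth_prime
  by (rule natural_density_eq)
    (use has_density_multiples[OF has_density_exact_divisors nth_prime_pos exact_divisors_multiple]
      in simp)

section \<open>Ascents and descents\<close>

abbreviation weighted_gap :: "nat \<Rightarrow> nat \<Rightarrow> int" where
  "weighted_gap n j \<equiv> (int (nth_prime (Suc n)) - int (nth_prime n) + 1) * numerator n j"

text \<open>Over the common denominator the difference is
  \<open>numerator (Suc n) j - nth_prime (Suc n) * numerator n j\<close>; the recursion for the
  first term yields the gap plus 1.\<close>

lemma d_diff:
  "d (Suc j) (nth_prime (Suc n)) - d (Suc j) (nth_prime n) =
     (lower_numerator n j - weighted_gap n j) / primorial (Suc (Suc n))"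
  by (simp add: d_nth_prime field_simps)

lemma d_less_iff:
  "d (Suc j) (nth_prime (Suc n)) < d (Suc j) (nth_prime n) \<longleftrightarrow> lower_numerator n j < weighted_gap n j"
  "d (Suc j) (nth_prime n) < d (Suc j) (nth_prime (Suc n)) \<longleftrightarrow> weighted_gap n j < lower_numerator n j"
proof -
  have pos: "0 < primorial (Suc (Suc n))" by (rule primorial_pos)
  have "x / p < 0 \<longleftrightarrow> x < 0" "0 < x / p \<longleftrightarrow> 0 < x" if "0 < p" for x p :: real
    using that by (simp_all add: divide_less_0_iff zero_less_divide_iff)
  note this[OF pos, of "real_of_int (lower_numerator n j - weighted_gap n j)", folded d_diff,
      unfolded of_int_less_0_iff of_int_0_less_iff diff_less_0_iff_less diff_gt_0_iff_gt]
  then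
  show "d (Suc j) (nth_prime (Suc n)) < d (Suc j) (nth_prime n) \<longleftrightarrow> lower_numerator n j < weighted_gap n j"
    and "d (Suc j) (nth_prime n) < d (Suc j) (nth_prime (Suc n)) \<longleftrightarrow> weighted_gap n j < lower_numerator n j"
    .
qed

section \<open>Size and limit of the densities\<close>

lemma nth_prime_ge_2: "2 \<le> nth_prime n"
  by (simp add: prime_ge_2_nat)

lemma numerator_nonneg: "0 \<le> numerator n j"
proof (induction n arbitrary: j)
  case (Suc n)
  then show ?case using nth_prime_ge_2[of n] by (auto split: nat.split)
qed simp

text \<open>At \<open>X = 1\<close> the product equals the primorial, which is therefore the sum of
  the nonnegative coefficients.\<close>

lemma numerator_le_primorial: "numerator n j \<le> primorial n"
proof (induction n arbitrary: j)
  case 0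
  then show ?case by simp
next
  case (Suc n)
  have "lower_numerator n j \<le> primorial n"
    using Suc primorial_pos[of n] by (auto split: nat.split simp: less_imp_le)
  moreover have "(real (nth_prime n) - 1) * numerator n j \<le> (real (nth_prime n) - 1) * primorial n"
    using nth_prime_ge_2[of n] by (intro mult_left_mono Suc) simp
  ultimately show ?case by (simp add: algebra_simps)
qed

lemma d_nonneg: "0 \<le> d (Suc j) (nth_prime n)"
  unfolding d_nth_prime using numerator_nonneg primorial_pos by (simp add: less_imp_le)

lemma d_tendsto_0: "(\<lambda>n. d (Suc j) (nth_prime n)) \<longlonglongrightarrow> 0"
proof (rule tendsto_sandwich)
  show "eventually (\<lambda>n. 0 \<le> d (Suc j) (nth_prime n)) sequentially"
    by (simp add: d_nonneg)
  have "d (Suc j) (nth_prime n) \<le> 1 / real n" if "0 < n" for n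
  proof -
    have "d (Suc j) (nth_prime n) \<le> primorial n / primorial (Suc n)"
      unfolding d_nth_prime
      by (intro divide_right_mono numerator_le_primorial less_imp_le[OF primorial_pos])
    also have "\<dots> = 1 / real (nth_prime n)"
      using primorial_pos[of n] by simp
    also have "\<dots> \<le> 1 / real n"
      using that le_nth_prime[of n] by (intro divide_left_mono) auto
    finally show ?thesis .
  qed
  then show "eventually (\<lambda>n. d (Suc j) (nth_prime n) \<le> 1 / real n) sequentially"
    using eventually_gt_at_top[of 0] by (rule eventually_mono[rotated])
qed (simp_all add: lim_1_over_n)

section \<open>The unimodular cases\<close>

lemma unimodular_dI:
  assumes "\<And>n. n < m \<Longrightarrow> weighted_gap n j \<le> lower_numerator n j"
    and "\<And>n. m \<le> n \<Longrightarrow> lower_numerator n j \<le> weighted_gap n j"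
  shows "unimodular (\<lambda>n. d (Suc j) (nth_prime n))"
  by (rule unimodularI[of m]) (use assms in \<open>simp_all add: d_less_iff flip: not_less\<close>)

lemma nth_prime_0: "nth_prime 0 = 2"
  unfolding nth_prime_def enumerate_0
  by (rule Least_equality) (auto simp: prime_ge_2_nat)

lemma nth_prime_Suc_ge: "int (nth_prime n) + 1 \<le> int (nth_prime (Suc n))"
  using nth_prime_less_iff[of n "Suc n"] by linarith

lemma odd_nth_prime: "0 < n \<Longrightarrow> odd (nth_prime n)"
  using nth_prime_less_iff[of 0 n]
  by (intro prime_odd_nat) (simp_all add: nth_prime_0)

lemma nth_prime_Suc_ge': "0 < n \<Longrightarrow> int (nth_prime n) + 2 \<le> int (nth_prime (Suc n))"
  using nth_prime_Suc_ge[of n] odd_nth_prime[of n] odd_nth_prime[of "Suc n"]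
  by presburger

text \<open>Consecutive primes differ by at least 1, and by at least 2 from 3 onwards by
  parity.\<close>

lemma weighted_gap_ge:
  "2 * numerator n j \<le> weighted_gap n j"
  "0 < n \<Longrightarrow> 3 * numerator n j \<le> weighted_gap n j"
  using nth_prime_Suc_ge[of n] nth_prime_Suc_ge'[of n]
  by (auto intro!: mult_right_mono numerator_nonneg)

lemma numerator_0_le_1: "0 < n \<Longrightarrow> numerator n 0 \<le> numerator n 1"
proof (induction n rule: nat_induct_non_zero)
  case 1
  then show ?case by (simp add: nth_prime_0)
next
  case (Suc n)
  have "(int (nth_prime n) - 1) * numerator n 0 \<le> (int (nth_prime n) - 1) * numerator n 1"
    using nth_prime_ge_2[of n] by (intro mult_left_mono Suc) simp
  then show ?case using numerator_nonneg[of n 0] by simp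
qed

lemma nth_prime_1_le: "nth_prime 1 \<le> 3"
proof -
  have "prime (3::nat)" by simp
  then obtain n where n: "3 = nth_prime n" by (rule nth_prime_exists)
  then have "n \<noteq> 0" by (metis nth_prime_0 numeral_eq_iff semiring_norm(88))
  then show ?thesis using n nth_prime_less_iff[of n 1] by linarith
qed

text \<open>The factor 3 matches \<open>weighted_gap_ge\<close> and is attained at
  \<open>n = 2\<close>, where the coefficients are 3 and 1. The induction step uses
  \<open>numerator_0_le_1\<close> for the carried terms.\<close>

lemma numerator_1_le_2: "2 \<le> n \<Longrightarrow> numerator n 1 \<le> 3 * numerator n 2"
proof (induction n rule: nat_induct_at_least)
  case base
  then show ?case using nth_prime_1_le by (simp add: nth_prime_0 numeral_2_eq_2)
next
  case (Suc n)
  have "(int (nth_prime n) - 1) * numerator n 1 \<le> (int (nth_prime n) - 1) * (3 * numerator n 2)"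
    using nth_prime_ge_2[of n] by (intro mult_left_mono Suc) simp
  then show ?case
    using numerator_0_le_1[of n] numerator_nonneg[of n 1] Suc by (simp add: numeral_2_eq_2)
qed

lemma unimodular_small:
  "unimodular (\<lambda>n. d 1 (nth_prime n))"
  "unimodular (\<lambda>n. d 2 (nth_prime n))"
  "unimodular (\<lambda>n. d 3 (nth_prime n))"
proof -
  have "unimodular (\<lambda>n. d (Suc 0) (nth_prime n))"
  proof (rule unimodular_dI[of 0])
    show "lower_numerator n 0 \<le> weighted_gap n 0" for n
      using weighted_gap_ge(1)[of n 0] numerator_nonneg[of n 0] by simp
  qed simp
  moreover have "unimodular (\<lambda>n. d (Suc 1) (nth_prime n))"
  proof (rule unimodular_dI[of 1])
    show "lower_numerator n 1 \<le> weighted_gap n 1" if "1 \<le> n" for n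
      using that weighted_gap_ge(1)[of n 1] numerator_nonneg[of n 1] numerator_0_le_1[of n] by simp
  qed simp
  moreover have "unimodular (\<lambda>n. d (Suc 2) (nth_prime n))"
  proof (rule unimodular_dI[of 2])
    show "lower_numerator n 2 \<le> weighted_gap n 2" if "2 \<le> n" for n
      using that weighted_gap_ge(2)[of n 2] numerator_1_le_2[of n] by (simp add: numeral_2_eq_2)
    \<comment> \<open>The product over fewer than two primes has degree below 2, so
      \<open>numerator n 2 = 0\<close>.\<close>
    show "weighted_gap n 2 \<le> lower_numerator n 2" if "n < 2" for n
      using that by (auto simp: numeral_2_eq_2 less_Suc_eq)
  qed
  ultimately show
    "unimodular (\<lambda>n. d 1 (nth_prime n))"
    "unimodular (\<lambda>n. d 2 (nth_prime n))"
    "unimodular (\<lambda>n. d 3 (nth_prime n))"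
    by (simp_all only: Suc_1 One_nat_def numeral_3_eq_3 numeral_2_eq_2)
qed

section \<open>The primes up to 1153\<close>

text \<open>Two factors above \<open>b\<close> would multiply to at least \<open>(b + 1)^2\<close>,
  so a composite \<open>x\<close> has a divisor \<open>e\<close> in \<open>{2..b}\<close>, and some
  \<open>q\<close> in \<open>Q\<close> divides \<open>e\<close>. The alternative
  \<open>x \<le> q\<close> lets the members of \<open>Q\<close> pass themselves.\<close>

lemma prime_trial_division:
  fixes x b :: int
  assumes "2 \<le> x" "x < (b + 1) ^ 2" "0 \<le> b"
    and Q: "\<forall>q\<in>Q. 2 \<le> q" "\<forall>e\<in>{2..b}. \<exists>q\<in>Q. q dvd e"
  shows "prime x \<longleftrightarrow> (\<forall>q\<in>Q. x mod q \<noteq> 0 \<or> x \<le> q)"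
proof
  assume "prime x"
  then show "\<forall>q\<in>Q. x mod q \<noteq> 0 \<or> x \<le> q"
    using Q by (auto simp: prime_int_iff' mod_eq_0_iff_dvd)
next
  assume *: "\<forall>q\<in>Q. x mod q \<noteq> 0 \<or> x \<le> q"
  show "prime x"
  proof (rule ccontr)
    assume "\<not> prime x"
    then obtain u where u: "2 \<le> u" "u < x" "u dvd x"
      using \<open>2 \<le> x\<close> by (auto simp: prime_int_iff')
    then obtain v where v: "x = u * v" by auto
    have "0 < v" using u v \<open>2 \<le> x\<close> by (metis less_le_trans zero_less_mult_pos zero_less_numeral)
    moreover have "v \<noteq> 1" using u v by auto
    ultimately have "2 \<le> v" by linarith
    then have "v < x" using u v by simp
    have large: "b < e" if e: "2 \<le> e" "e < x" "e dvd x" for e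
    proof (rule ccontr)
      assume "\<not> b < e"
      then have "e \<in> {2..b}" using e by simp
      then obtain q where q: "q \<in> Q" "q dvd e" using Q by blast
      have "q \<le> e" using q e by (intro zdvd_imp_le) simp_all
      moreover have "x mod q = 0" using q e by (metis dvd_trans dvd_imp_mod_0)
      ultimately show False using bspec[OF * q(1)] e by simp
    qed
    have "b < u" "b < v" using large u \<open>2 \<le> v\<close> \<open>v < x\<close> v by auto
    then have "(b + 1) * (b + 1) \<le> u * v"
      using \<open>0 \<le> b\<close> by (intro mult_mono) auto
    then show False using assms v by (simp add: power2_eq_square)
  qed
qed

text \<open>Divisors up to \<open>33\<close> suffice because \<open>1153 < 34^2\<close>.\<close>

definition trial_divisors :: "int list" where
  "trial_divisors = [2, 3, 5, 7, 11, 13, 17, 19, 23, 29, 31]"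

definition small_primes :: "int list" where
  "small_primes = filter (\<lambda>x. list_all (\<lambda>q. x mod q \<noteq> 0 \<or> x \<le> q) trial_divisors) [2..1153]"

lemma trial_divisors_complete: "\<forall>e\<in>{2..33}. \<exists>q\<in>set trial_divisors. q dvd e"
proof -
  have "list_all (\<lambda>e. \<not> list_all (\<lambda>q. e mod q \<noteq> 0) trial_divisors) [2..33]"
    by code_simp
  then show ?thesis by (auto simp: list_all_iff simp del: upto_rec_numeral)
qed

text \<open>Both lists are sorted and distinct with the same elements, the primes up to 1153, hence
  equal.\<close>

lemma small_primes_nth:
  assumes "i < length small_primes"
  shows "small_primes ! i = int (nth_prime i)"
proof -
  define m where "m = (LEAST m. 1153 < nth_prime m)"
  \<comment> \<open>This witness makes the \<open>LEAST\<close> meaningful; \<open>m\<close> is the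
    number of primes up to 1153.\<close>
  have "1153 < nth_prime 1154" using le_nth_prime[of 1154] by linarith
  then have m: "1153 < nth_prime m" unfolding m_def by (rule LeastI)
  have below_m: "nth_prime i \<le> 1153 \<longleftrightarrow> i < m" for i
  proof
    assume "nth_prime i \<le> 1153"
    then have "nth_prime i < nth_prime m" using m by linarith
    then show "i < m" by simp
  next
    assume "i < m"
    then show "nth_prime i \<le> 1153" unfolding m_def using not_less_Least by fastforce
  qed
  have "x \<in> set small_primes \<longleftrightarrow> (2 \<le> x \<and> x \<le> 1153) \<and> prime x" for x
  proof -
    have "\<forall>q\<in>set trial_divisors. 2 \<le> q" by (simp add: trial_divisors_def)
    note prime_trial_division[OF _ _ _ this trial_divisors_complete, of x]
    then show ?thesis
      by (auto simp: small_primes_def list_all_iff simp del: upto_rec_numeral)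
  qed
  moreover have "prime x \<and> x \<le> 1153 \<longleftrightarrow> (\<exists>i<m. x = int (nth_prime i))" for x
  proof
    assume x: "prime x \<and> x \<le> 1153"
    then have "prime (nat x)" "int (nat x) = x" using prime_ge_0_int[of x] by auto
    obtain i where "nat x = nth_prime i" using nth_prime_exists[OF \<open>prime (nat x)\<close>] .
    then have "x = int (nth_prime i)" using \<open>int (nat x) = x\<close> by simp
    then show "\<exists>i<m. x = int (nth_prime i)" using x below_m[of i] by auto
  next
    assume "\<exists>i<m. x = int (nth_prime i)"
    then obtain i where "i < m" and x: "x = int (nth_prime i)" by blast
    then have "nth_prime i \<le> 1153" using below_m by simp
    then show "prime x \<and> x \<le> 1153" unfolding x by simp
  qed
  ultimately have set: "x \<in> set small_primes \<longleftrightarrow> (\<exists>i<m. x = int (nth_prime i))" for x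
    using prime_ge_2_int by blast
  have "set small_primes = set (map (\<lambda>i. int (nth_prime i)) [0..<m])"
    unfolding set_eq_iff set by auto
  moreover have "sorted small_primes" "distinct small_primes"
    unfolding small_primes_def by (simp_all only: sorted_wrt_filter distinct_filter sorted_upto distinct_upto)
  moreover have "sorted (map (\<lambda>i. int (nth_prime i)) [0..<m])"
    by (auto simp: sorted_iff_nth_mono simp flip: not_less)
  moreover have "distinct (map (\<lambda>i. int (nth_prime i)) [0..<m])"
    by (simp add: distinct_map inj_on_def)
  ultimately have eq: "small_primes = map (\<lambda>i. int (nth_prime i)) [0..<m]"
    by (intro sorted_distinct_set_unique)
  then have "length small_primes = m" by (metis length_map length_upt minus_nat.diff_0)
  then have "i < m" using assms by simp
  then show ?thesis unfolding eq by simp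
qed

section \<open>The non-unimodular cases\<close>

abbreviation falls :: "nat \<Rightarrow> nat \<Rightarrow> bool" where
  "falls n j \<equiv> lower_numerator n j < weighted_gap n j"

abbreviation rises :: "nat \<Rightarrow> nat \<Rightarrow> bool" where
  "rises n j \<equiv> weighted_gap n j < lower_numerator n j"

text \<open>The positive degree \<open>Suc j\<close> makes the sequence start at 0.\<close>

lemma not_unimodular_dI:
  assumes "falls i (Suc j)" "rises l (Suc j)" "i < l"
  shows "\<not> unimodular (\<lambda>n. d (Suc (Suc j)) (nth_prime n))"
proof (rule not_unimodularI)
  show "d (Suc (Suc j)) (nth_prime 0) = 0" by (simp add: d_nth_prime)
qed (use assms in \<open>simp_all only: d_nonneg d_tendsto_0 d_less_iff\<close>)

text \<open>
  The coefficients are computed only up to a common scaling factor and a common error bound \<open>e\<close>,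
  since the exact integers reach well over a thousand bits. In \<open>phase\<close>, \<open>Rose\<close> stands for a rise
  after a fall.
\<close>

datatype phase = Start | Fell | Rose

text \<open>Here \<open>a\<close> and \<open>c\<close> are lower bounds, with error at most
  \<open>e\<close>, for the scaled \<open>lower_numerator\<close> and \<open>numerator\<close>;
  \<open>g\<close> is the gap plus 1. Only comparisons that the error cannot reverse change the
  phase.\<close>

fun next_phase :: "int \<Rightarrow> int \<Rightarrow> phase \<Rightarrow> int \<Rightarrow> int \<Rightarrow> phase" where
  "next_phase g e Start a c = (if a + e < g * c then Fell else Start)"
| "next_phase g e Fell a c = (if g * (c + e) < a then Rose else Fell)"
| "next_phase g e Rose a c = Rose"

fun next_phases :: "int \<Rightarrow> int \<Rightarrow> phase list \<Rightarrow> int \<Rightarrow> int list \<Rightarrow> phase list" where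
  "next_phases g e (f # fs) a (c # cs) = next_phase g e f a c # next_phases g e fs c cs"
| "next_phases g e _ a _ = []"

text \<open>With \<open>a = 0\<close> this multiplies a polynomial, lowest degree first, by
  \<open>w + X\<close>, truncated to the given length; \<open>a\<close> carries the preceding
  coefficient.\<close>

fun mult_linear :: "int \<Rightarrow> int \<Rightarrow> int list \<Rightarrow> int list" where
  "mult_linear w a [] = []"
| "mult_linear w a (c # cs) = (w * c + a) # mult_linear w c cs"

text \<open>The constant coefficient serves as the gauge of size. One step multiplies it by
  \<open>p - 1\<close>, less than the \<open>2^16\<close> that a shrink removes.\<close>

definition shrink :: "int list \<Rightarrow> int list" where
  "shrink cs = (if hd cs < 1000000000000000000000000000000 then cs else map (drop_bit 16) cs)"

text \<open>Rounding down loses less than one unit on the entry and less than one on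
  \<open>e\<close>, hence the 2.\<close>

definition shrink_error :: "int \<Rightarrow> int list \<Rightarrow> int" where
  "shrink_error e cs =
     (if hd cs < 1000000000000000000000000000000 then e else drop_bit 16 e + 2)"

fun scan :: "int \<Rightarrow> int list \<Rightarrow> phase list \<Rightarrow> int list \<Rightarrow> phase list" where
  "scan e cs fs (p # q # ps) =
     scan (p * shrink_error e cs) (mult_linear (p - 1) 0 (shrink cs))
       (next_phases (q - p + 1) e fs 0 cs) (q # ps)"
| "scan e cs fs _ = fs"

section \<open>Soundness of the approximate scan\<close>

lemma length_mult_linear [simp]: "length (mult_linear w a cs) = length cs"
  by (induction w a cs rule: mult_linear.induct) auto

lemma nth_mult_linear:
  "i < length cs \<Longrightarrow>
     mult_linear w a cs ! i = w * cs ! i + (case i of 0 \<Rightarrow> a | Suc k \<Rightarrow> cs ! k)"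
proof (induction w a cs arbitrary: i rule: mult_linear.induct)
  case (2 w a c cs)
  then show ?case by (cases i) (auto split: nat.split)
qed simp

lemma length_next_phases [simp]: "length (next_phases g e fs a cs) = min (length fs) (length cs)"
  by (induction g e fs a cs rule: next_phases.induct) auto

lemma nth_next_phases:
  "i < length fs \<Longrightarrow> i < length cs \<Longrightarrow>
     next_phases g e fs a cs ! i =
       next_phase g e (fs ! i) (case i of 0 \<Rightarrow> a | Suc k \<Rightarrow> cs ! k) (cs ! i)"
proof (induction g e fs a cs arbitrary: i rule: next_phases.induct)
  case (1 g e f fs a c cs)
  then show ?case by (cases i) (auto split: nat.split)
qed auto

text \<open>A single positive scale \<open>u\<close> for all coefficients cancels in every
  comparison between them.\<close>

definition encloses :: "real \<Rightarrow> nat \<Rightarrow> int \<Rightarrow> int list \<Rightarrow> bool" where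
  "encloses u n e cs \<longleftrightarrow> 0 < u \<and>
     (\<forall>j<length cs. real_of_int (cs ! j) \<le> u * real_of_int (numerator n j) \<and>
       u * real_of_int (numerator n j) \<le> real_of_int (cs ! j + e))"

lemma encloses_lower:
  assumes "encloses u n e cs" "j < length cs"
  defines "a \<equiv> (case j of 0 \<Rightarrow> 0 | Suc k \<Rightarrow> cs ! k)"
  shows "real_of_int a \<le> u * real_of_int (lower_numerator n j) \<and>
    u * real_of_int (lower_numerator n j) \<le> real_of_int (a + e)"
proof (cases j)
  case 0
  \<comment> \<open>The enclosure itself yields \<open>0 \<le> e\<close>, so the exact 0 below
    degree 0 is enclosed too.\<close>
  have "real_of_int (cs ! j) \<le> real_of_int (cs ! j + e)"
    using assms(1,2) unfolding encloses_def by (meson order_trans)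
  then show ?thesis using 0 by (simp add: a_def)
next
  case (Suc k)
  then have "k < length cs" using assms(2) by simp
  then show ?thesis using assms(1) Suc unfolding a_def encloses_def by simp
qed

lemma encloses_shrink:
  assumes "encloses u n e cs"
  shows "\<exists>v. encloses v n (shrink_error e cs) (shrink cs)"
proof (cases "hd cs < 1000000000000000000000000000000")
  case True
  then show ?thesis using assms unfolding shrink_def shrink_error_def by auto
next
  case False
  have floor: "real_of_int (x div 65536) \<le> y / 65536 \<and> y / 65536 \<le> x div 65536 + (z div 65536 + 2)"
    if "real_of_int x \<le> y" "y \<le> x + z" for x z :: int and y :: real
  proof -
    have "real_of_int (x div 65536 * 65536) \<le> x" 
      "real_of_int (x + z) \<le> (x div 65536 + (z div 65536 + 2)) * 65536"
      by (simp_all only: of_int_le_iff) presburger+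
    then show ?thesis using that by simp
  qed
  have "encloses (u / 65536) n (drop_bit 16 e + 2) (map (drop_bit 16) cs)"
    using assms floor unfolding encloses_def by (auto simp: drop_bit_eq_div)
  then show ?thesis using False unfolding shrink_def shrink_error_def by auto
qed

text \<open>The errors \<open>(p - 1) * e\<close> and \<open>e\<close> of the two summands add up to
  \<open>p * e\<close>.\<close>

lemma encloses_mult_linear:
  assumes "encloses u n e cs"
  shows "encloses u (Suc n) (int (nth_prime n) * e) (mult_linear (int (nth_prime n) - 1) 0 cs)"
proof -
  define w where "w = int (nth_prime n) - 1"
  have p: "int (nth_prime n) = w + 1" by (simp add: w_def)
  have w: "0 \<le> w" using nth_prime_ge_2[of n] by (simp add: w_def)
  have "real_of_int (mult_linear w 0 cs ! j) \<le> u * real_of_int (numerator (Suc n) j) \<and>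
      u * real_of_int (numerator (Suc n) j) \<le> real_of_int (mult_linear w 0 cs ! j + (w + 1) * e)" if "j < length cs" for j
  proof -
    define a where "a = (case j of 0 \<Rightarrow> 0 | Suc k \<Rightarrow> cs ! k)"
    have "real_of_int a \<le> u * real_of_int (lower_numerator n j)"
      "u * real_of_int (lower_numerator n j) \<le> real_of_int (a + e)"
      using encloses_lower[OF assms that] by (simp_all add: a_def)
    moreover have "real_of_int w * real_of_int (cs ! j) \<le> real_of_int w * (u * real_of_int (numerator n j))"
      "real_of_int w * (u * real_of_int (numerator n j)) \<le> real_of_int w * real_of_int (cs ! j + e)"
      using assms that w unfolding encloses_def by (auto intro!: mult_left_mono simp del: of_int_add)
    ultimately show ?thesis
      using that by (simp add: nth_mult_linear p algebra_simps flip: a_def)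
  qed
  then show ?thesis using assms unfolding encloses_def p by simp
qed

text \<open>The bound \<open>i < n\<close> for \<open>Fell\<close> ensures that a rise found at
  index \<open>n\<close> comes after the fall.\<close>

fun phase_ok :: "nat \<Rightarrow> nat \<Rightarrow> phase \<Rightarrow> bool" where
  "phase_ok n j Start \<longleftrightarrow> True"
| "phase_ok n j Fell \<longleftrightarrow> (\<exists>i<n. falls i j)"
| "phase_ok n j Rose \<longleftrightarrow> (\<exists>i l. i < l \<and> falls i j \<and> rises l j)"

lemma phase_ok_next:
  assumes enc: "encloses u n e cs" and j: "j < length cs" and ok: "phase_ok n j f"
  shows "phase_ok (Suc n) j
    (next_phase (int (nth_prime (Suc n)) - int (nth_prime n) + 1) e f
      (case j of 0 \<Rightarrow> 0 | Suc k \<Rightarrow> cs ! k) (cs ! j))"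
proof -
  define g where "g = int (nth_prime (Suc n)) - int (nth_prime n) + 1"
  define a where "a = (case j of 0 \<Rightarrow> 0 | Suc k \<Rightarrow> cs ! k)"
  have g: "0 \<le> g" using nth_prime_Suc_ge[of n] by (simp add: g_def)
  have u: "0 < u" using enc by (simp add: encloses_def)
  have a: "real_of_int a \<le> u * real_of_int (lower_numerator n j)"
      "u * real_of_int (lower_numerator n j) \<le> real_of_int (a + e)"
    using encloses_lower[OF enc j] by (simp_all add: a_def)
  have c: "real_of_int (g * cs ! j) \<le> u * real_of_int (g * numerator n j)"
    "u * real_of_int (g * numerator n j) \<le> real_of_int (g * (cs ! j + e))"
  proof -
    have "real_of_int (cs ! j) \<le> u * real_of_int (numerator n j)"
      "u * real_of_int (numerator n j) \<le> real_of_int (cs ! j + e)"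
      using enc j by (simp_all add: encloses_def)
    then have "real_of_int g * real_of_int (cs ! j) \<le> real_of_int g * (u * real_of_int (numerator n j))"
      "real_of_int g * (u * real_of_int (numerator n j)) \<le> real_of_int g * real_of_int (cs ! j + e)"
      using g by (auto intro!: mult_left_mono simp del: of_int_add)
    then show "real_of_int (g * cs ! j) \<le> u * real_of_int (g * numerator n j)"
      "u * real_of_int (g * numerator n j) \<le> real_of_int (g * (cs ! j + e))"
      by (simp_all add: mult.left_commute)
  qed
  have fall: "falls n j" if "a + e < g * cs ! j"
  proof -
    have "real_of_int (a + e) < real_of_int (g * cs ! j)" using that by (simp only: of_int_less_iff)
    then have "u * real_of_int (lower_numerator n j) < u * real_of_int (g * numerator n j)" using a c by linarith
    then show ?thesis
      unfolding g_def[symmetric] by (simp only: mult_less_cancel_left_pos[OF u] of_int_less_iff)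
  qed
  have rise: "rises n j" if "g * (cs ! j + e) < a"
  proof -
    have "real_of_int (g * (cs ! j + e)) < real_of_int a" using that by (simp only: of_int_less_iff)
    then have "u * real_of_int (g * numerator n j) < u * real_of_int (lower_numerator n j)" using a c by linarith
    then show ?thesis
      unfolding g_def[symmetric] by (simp only: mult_less_cancel_left_pos[OF u] of_int_less_iff)
  qed
  have "phase_ok (Suc n) j (next_phase g e f a (cs ! j))"
  proof (cases f)
    case Start
    then show ?thesis using fall by (cases "a + e < g * cs ! j") (simp, blast, simp)
  next
    case Fell
    then obtain i where i: "i < n" "falls i j" using ok by (simp only: phase_ok.simps) blast
    then have "i < Suc n" by simp
    show ?thesis
    proof (cases "g * (cs ! j + e) < a")
      case True
      then show ?thesis using Fell i rise by (simp only: next_phase.simps if_True phase_ok.simps) blast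
    next
      case False
      then show ?thesis using Fell i \<open>i < Suc n\<close>
        by (simp only: next_phase.simps if_False phase_ok.simps) blast
    qed
  next
    case Rose
    then show ?thesis using ok by (simp only: next_phase.simps phase_ok.simps)
  qed
  then show ?thesis by (simp only: g_def a_def)
qed

text \<open>The scale \<open>u\<close> changes with each shrink and \<open>n\<close> with each
  prime, so the induction generalizes both. The claim for \<open>Rose\<close> does not depend on
  \<open>n'\<close>.\<close>

lemma scan_sound:
  assumes "\<And>i. i < length ps \<Longrightarrow> ps ! i = int (nth_prime (n + i))"
    and "encloses u n e cs" "length cs = m" "length fs = m"
    and "\<And>j. j < m \<Longrightarrow> phase_ok n j (fs ! j)" "j < m"
  shows "\<exists>n'. phase_ok n' j (scan e cs fs ps ! j)"
  using assms
proof (induction e cs fs ps arbitrary: n u rule: scan.induct)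
  case (1 e cs fs p q ps)
  have p: "p = int (nth_prime n)" "q = int (nth_prime (Suc n))"
    using "1.prems"(1)[of 0] "1.prems"(1)[of 1] by simp_all
  obtain v where v: "encloses v n (shrink_error e cs) (shrink cs)"
    using encloses_shrink "1.prems"(2) by blast
  show ?case unfolding scan.simps
  proof (rule "1.IH"[of "Suc n"])
    show "(q # ps) ! i = int (nth_prime (Suc n + i))" if "i < length (q # ps)" for i
      using "1.prems"(1)[of "Suc i"] that by simp
    show "encloses v (Suc n) (p * shrink_error e cs) (mult_linear (p - 1) 0 (shrink cs))"
      unfolding p by (rule encloses_mult_linear[OF v])
    show "length (mult_linear (p - 1) 0 (shrink cs)) = m"
      using "1.prems"(3) by (simp add: shrink_def)
    show "length (next_phases (q - p + 1) e fs 0 cs) = m"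
      using "1.prems"(3,4) by simp
    show "phase_ok (Suc n) i (next_phases (q - p + 1) e fs 0 cs ! i)" if "i < m" for i
      using that phase_ok_next[OF "1.prems"(2), of i "fs ! i"] "1.prems"(3,4,5)
      by (simp add: nth_next_phases p del: numerator.simps)
  qed fact
qed auto

text \<open>The 20 positions are the degrees \<open>k - 1\<close> for \<open>k\<close> from 1 to 20;
  \<open>drop 3\<close> leaves the cases from 4 on, all settled by one evaluation.\<close>

lemma scan_small_primes:
  "drop 3 (scan 0 (1 # replicate 19 0) (replicate 20 Start) small_primes) = replicate 17 Rose"
  by code_simp

lemma not_unimodular_large:
  assumes "k \<in> {4..20}"
  shows "\<not> unimodular (\<lambda>n. d k (nth_prime n))"
proof -
  define j where "j = k - 4"
  have k: "k = Suc (Suc (j + 2))" and j: "j < 17" using assms by (auto simp: j_def)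
  define cs :: "int list" where "cs = 1 # replicate 19 0"
  define fs where "fs = scan 0 cs (replicate 20 Start) small_primes"
  have "\<exists>n'. phase_ok n' (3 + j) (fs ! (3 + j))"
    unfolding fs_def
  proof (rule scan_sound)
    \<comment> \<open>The empty product 1 is represented exactly.\<close>
    show "encloses 1 0 0 cs"
      by (simp add: encloses_def cs_def nth_Cons')
    show "small_primes ! i = int (nth_prime (0 + i))" if "i < length small_primes" for i
      using small_primes_nth[OF that] by simp
    show "phase_ok 0 i (replicate 20 Start ! i)" if "i < 20" for i
      using that by (simp only: nth_replicate phase_ok.simps)
    show "3 + j < 20" using j by linarith
  qed (simp_all add: cs_def)
  moreover have "fs ! (3 + j) = Rose"
  proof -
    have drop: "drop 3 fs = replicate 17 Rose"
      unfolding fs_def cs_def by (rule scan_small_primes)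
    have "length fs - 3 = 17" using arg_cong[OF drop, of length] by simp
    then have "fs ! (3 + j) = drop 3 fs ! j" by simp
    then show ?thesis using j by (simp only: drop nth_replicate)
  qed
  ultimately obtain i l where "i < l" "falls i (3 + j)" "rises l (3 + j)"
    by (simp only: phase_ok.simps) blast
  moreover have "3 + j = Suc (j + 2)" by simp
  ultimately show ?thesis unfolding k by (intro not_unimodular_dI) simp_all
qed

theorem theorem5:
  "(\<forall>k\<in>{1, 2, 3}. unimodular (\<lambda>n. d k (nth_prime n))) \<and>
   (\<forall>k\<in>{4..20}. \<not> unimodular (\<lambda>n. d k (nth_prime n)))"
  using unimodular_small not_unimodular_large by blast

end
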